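(* Let $(\mathcal{A},\odot,\mathfrak{B})$ be a quadratic Zinbiel superalgebra over a field $\mathbb{K}$ of dimension $(n,m)$ (i.e. $\dim\mathcal{A}_{\bar 0}=n$, $\dim\mathcal{A}_{\bar 1}=m$) such that $n\ge 2$. If ${\rm Ann}(\mathcal{A})\cap\mathcal{A}_{\bar 0}\neq\{0\}$, then $\mathcal{A}$ is isomorphic to an even double extension of a quadratic Zinbiel superalgebra $(\mathcal{H},\cdot,\mathfrak{B}_{\mathcal{H}})$ of dimension $(n-2,m)$ by the one-dimensional vector space.
   Context: A superalgebra is a finite-dimensional $\mathbb{Z}_2$-graded vector space $\mathcal{A}=\mathcal{A}_{\bar 0}\oplus\mathcal{A}_{\bar 1}$ over $\mathbb{K}$ with a bilinear product satisfying $\mathcal{A}_i\mathcal{A}_j\subset\mathcal{A}_{i+j}$; $|x|$ is the degree of a homogeneous $x$. Left Zinbiel: $(xy)z=x(yz)+(-1)^{|y||z|}x(zy)$; right Zinbiel: $x(yz)=(xy)z+(-1)^{|x||y|}(yx)z$ (for homogeneous elements); symmetric Zinbiel: both. ${\rm Ann}(\mathcal{A})=\{a: a\mathcal{A}=\mathcal{A}a=0\}$, and $\mathcal{A}^2$ is the span of all products. A quadratic Zinbiel superalgebra is a left (or right) Zinbiel superalgebra with a non-degenerate bilinear form $\mathfrak{B}$ that is supersymmetric ($\mathfrak{B}(x,y)=(-1)^{|x||y|}\mathfrak{B}(y,x)$), invariant ($\mathfrak{B}(xy,z)=\mathfrak{B}(x,yz)$) and even ($\mathfrak{B}(\mathcal{A}_{\bar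 0},\mathcal{A}_{\bar 1})=\mathfrak{B}(\mathcal{A}_{\bar 1},\mathcal{A}_{\bar 0})=0$). Such a superalgebra is automatically symmetric Zinbiel. Admissible triple: let $\mathcal{H}$ be a symmetric Zinbiel superalgebra, $\delta,D$ homogeneous endomorphisms of $\mathcal{H}$ of degree $|d|$, and $\mathfrak{a}_0\in{\rm Ann}(\mathcal{H})\cap\mathcal{H}_{\bar 0}$. $(\delta,D,\mathfrak{a}_0)$ is admissible if for all homogeneous $x,y\in\mathcal{H}$: $\delta(xy)=(-1)^{|d||x|}x\delta(y)=\delta(x)y+(-1)^{|d||x|}D(x)y=-(-1)^{|y|(|x|+|d|)}D(y)x$; $\delta(x)y=(-1)^{|x||y|}\delta(y)x=-(-1)^{|d|(|x|+|y|)}xD(y)$; $D(xy)=(-1)^{|d||y|}D(x)y$; $\delta^2(x)=(-1)^{|d|}\delta^2(x)=-D^2(x)=(1+(-1)^{|d|})\mathfrak{a}_0x$; $\delta\circ D(x)=-(-1)^{|d|}D\circ\delta(x)=(-1)^{|d||x|}x\mathfrak{a}_0=-(-1)^{|d|(|x|+|d|)}\mathfrak{a}_0x$; $\delta(\mathfrak{a}_0)=D(\mathfrak{a}_0)=0$. Even double extension: let $(\mathcal{H},\cdot,\mathfrak{B}_{\mathcal{H}})$ be a quadratic Zinbiel superalgebra, $\mathcal{V}=\mathbb{K}d$ with $d$ even, and $(\delta,\delta^*,\mathfrak{a}_0)$ an admissible triple of $\mathcal{H}$ (with $|d|=\bar 0$), $\delta^*$ being the adjoint of $\delta$ with respect to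 $\mathfrak{B}_{\mathcal{H}}$, such that $\delta(\mathcal{H})\subseteq{\rm Ann}(\mathcal{H})$, $\delta(\mathcal{H}^2)=\{0\}$, $\delta^2=\delta\circ\delta^*=\delta^*\circ\delta=0$, $\mathfrak{a}_0\in{\rm Ann}(\mathcal{H})\cap\mathcal{H}_{\bar 0}$, $\mathfrak{B}_{\mathcal{H}}(\mathfrak{a}_0,\mathfrak{a}_0)=0$; let $\alpha\in\mathbb{K}$. The even double extension of $\mathcal{H}$ by $\mathcal{V}$ by means of $(\delta,\delta^*,\mathfrak{a}_0)$ is $\overline{\mathcal{H}}=\mathcal{V}^*\oplus\mathcal{H}\oplus\mathcal{V}$, $\mathcal{V}^*=\mathbb{K}d^*$, with product $d\odot d=\mathfrak{a}_0+\alpha d^*$, $d\odot x=\delta(x)+\mathfrak{B}_{\mathcal{H}}(x,\mathfrak{a}_0)d^*$, $x\odot y=xy+\mathfrak{B}_{\mathcal{H}}(\delta(x),y)d^*$, $x\odot d=\delta^*(x)+\mathfrak{B}_{\mathcal{H}}(x,\mathfrak{a}_0)d^*$ for $x,y\in\mathcal{H}$ (all products involving $d^*$ zero), and with the form $\overline{\mathfrak{B}}$ extending $\mathfrak{B}_{\mathcal{H}}$ by $\overline{\mathfrak{B}}(d,d^* )=\overline{\mathfrak{B}}(d^*,d)=1$ (other pairings of summands zero). "Isomorphic" means isomorphic as Zinbiel superalgebras.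
   Formalization: The field K is assumed to have characteristic different from 2; over fields of characteristic 2 the statement is false (there is a counterexample of dimension (5,4) over the field with two elements). *)

theory Defs
  imports Complex_Main "HOL-Library.Z2" "HOL-Library.Product_Plus"
begin

text \<open>
  Degrees are elements of \<^typ>\<open>bit\<close>, the integers modulo 2. A graded space is a family
  \<^term>\<open>A :: bit \<Rightarrow> 'v set\<close> of subspaces of an ambient vector space that is neither
  assumed to be finite-dimensional nor to be exhausted by the family; products, forms and maps
  only matter on \<open>total A\<close>. An identity for homogeneous elements is stated for all degrees
  \<open>i\<close>, \<open>j\<close> and all elements of \<open>A i\<close>, \<open>A j\<close>.
\<close>

definition ssign :: "bit \<Rightarrow> 'k::ring_1" where
  "ssign i = (if i = 0 then 1 else - 1)"

definition total :: "(bit \<Rightarrow> 'v::ab_group_add set) \<Rightarrow> 'v set" where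
  "total A = {x + y | x y. x \<in> A 0 \<and> y \<in> A 1}"

definition linear_on ::
  "('k \<Rightarrow> 'v::ab_group_add \<Rightarrow> 'v) \<Rightarrow> 'v set \<Rightarrow> ('k \<Rightarrow> 'w::ab_group_add \<Rightarrow> 'w) \<Rightarrow> ('v \<Rightarrow> 'w) \<Rightarrow> bool"
  where
  "linear_on s V s' f \<longleftrightarrow>
     (\<forall>x\<in>V. \<forall>y\<in>V. f (x + y) = f x + f y) \<and> (\<forall>c. \<forall>x\<in>V. f (s c x) = s' c (f x))"

definition bilinear_on ::
  "('k \<Rightarrow> 'v::ab_group_add \<Rightarrow> 'v) \<Rightarrow> 'v set \<Rightarrow> ('k \<Rightarrow> 'w::ab_group_add \<Rightarrow> 'w) \<Rightarrow> ('v \<Rightarrow> 'v \<Rightarrow> 'w) \<Rightarrow> bool"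
  where
  "bilinear_on s V s' f \<longleftrightarrow>
     (\<forall>y\<in>V. linear_on s V s' (\<lambda>x. f x y)) \<and> (\<forall>x\<in>V. linear_on s V s' (f x))"

definition annihilator ::
  "(bit \<Rightarrow> 'v::ab_group_add set) \<Rightarrow> ('v \<Rightarrow> 'v \<Rightarrow> 'v) \<Rightarrow> 'v set" where
  "annihilator A mult = {a \<in> total A. \<forall>x\<in>total A. mult a x = 0 \<and> mult x a = 0}"

locale superspace = vector_space scale
  for scale :: "'k::field \<Rightarrow> 'v::ab_group_add \<Rightarrow> 'v" (infixr "*s" 75) +
  fixes A :: "bit \<Rightarrow> 'v set"
  assumes subspace_part: "subspace (A i)"
    and direct: "A 0 \<inter> A 1 = {0}"
    and finite_dimensional: "\<exists>S. finite S \<and> span S = total A"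

locale superalgebra = superspace scale A
  for scale :: "'k::field \<Rightarrow> 'v::ab_group_add \<Rightarrow> 'v" (infixr "*s" 75)
    and A :: "bit \<Rightarrow> 'v set" +
  fixes mult :: "'v \<Rightarrow> 'v \<Rightarrow> 'v" (infixl "\<cdot>" 70)
  assumes bilinear_mult: "bilinear_on scale (total A) scale mult"
    and mult_graded: "\<lbrakk>x \<in> A i; y \<in> A j\<rbrakk> \<Longrightarrow> x \<cdot> y \<in> A (i + j)"
begin

definition square :: "'v set" where
  "square = span {x \<cdot> y | x y. x \<in> total A \<and> y \<in> total A}"

end

locale left_zinbiel_superalgebra = superalgebra +
  assumes left_zinbiel:
    "\<lbrakk>x \<in> A i; y \<in> A j; z \<in> A k\<rbrakk> \<Longrightarrow> (x \<cdot> y) \<cdot> z = x \<cdot> (y \<cdot> z) + ssign (j * k) *s (x \<cdot> (z \<cdot> y))"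

locale right_zinbiel_superalgebra = superalgebra +
  assumes right_zinbiel:
    "\<lbrakk>x \<in> A i; y \<in> A j; z \<in> A k\<rbrakk> \<Longrightarrow> x \<cdot> (y \<cdot> z) = (x \<cdot> y) \<cdot> z + ssign (i * j) *s ((y \<cdot> x) \<cdot> z)"

locale symmetric_zinbiel_superalgebra =
  left_zinbiel_superalgebra + right_zinbiel_superalgebra

locale quadratic_zinbiel_superalgebra = superalgebra scale A mult
  for scale :: "'k::field \<Rightarrow> 'v::ab_group_add \<Rightarrow> 'v" (infixr "*s" 75)
    and A :: "bit \<Rightarrow> 'v set"
    and mult :: "'v \<Rightarrow> 'v \<Rightarrow> 'v" (infixl "\<cdot>" 70) +
  fixes B :: "'v \<Rightarrow> 'v \<Rightarrow> 'k"
  assumes left_or_right_zinbiel: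
      "left_zinbiel_superalgebra scale A mult \<or> right_zinbiel_superalgebra scale A mult"
    and bilinear_form: "bilinear_on scale (total A) (*) B"
    and nondegenerate: "\<lbrakk>x \<in> total A; \<forall>y\<in>total A. B x y = 0\<rbrakk> \<Longrightarrow> x = 0"
    and supersymmetric: "\<lbrakk>x \<in> A i; y \<in> A j\<rbrakk> \<Longrightarrow> B x y = ssign (i * j) * B y x"
    and invariant: "\<lbrakk>x \<in> total A; y \<in> total A; z \<in> total A\<rbrakk> \<Longrightarrow> B (x \<cdot> y) z = B x (y \<cdot> z)"
    and even_form: "\<lbrakk>x \<in> A 0; y \<in> A 1\<rbrakk> \<Longrightarrow> B x y = 0 \<and> B y x = 0"

locale admissible_triple = symmetric_zinbiel_superalgebra scale H mult
  for scale :: "'k::field \<Rightarrow> 'v::ab_group_add \<Rightarrow> 'v" (infixr "*s" 75)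
    and H :: "bit \<Rightarrow> 'v set"
    and mult :: "'v \<Rightarrow> 'v \<Rightarrow> 'v" (infixl "\<cdot>" 70) +
  fixes d :: bit and \<delta> D :: "'v \<Rightarrow> 'v" and a0 :: 'v
  assumes linear_\<delta>: "linear_on scale (total H) scale \<delta>"
    and linear_D: "linear_on scale (total H) scale D"
    and degree_\<delta>: "x \<in> H i \<Longrightarrow> \<delta> x \<in> H (i + d)"
    and degree_D: "x \<in> H i \<Longrightarrow> D x \<in> H (i + d)"
    and a0_mem: "a0 \<in> annihilator H mult \<inter> H 0"
    and adm1: "\<lbrakk>x \<in> H i; y \<in> H j\<rbrakk> \<Longrightarrow>
          \<delta> (x \<cdot> y) = ssign (d * i) *s (x \<cdot> \<delta> y)
        \<and> ssign (d * i) *s (x \<cdot> \<delta> y) = \<delta> x \<cdot> y + ssign (d * i) *s (D x \<cdot> y)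
        \<and> \<delta> x \<cdot> y + ssign (d * i) *s (D x \<cdot> y) = - (ssign (j * (i + d)) *s (D y \<cdot> x))"
    and adm2: "\<lbrakk>x \<in> H i; y \<in> H j\<rbrakk> \<Longrightarrow>
          \<delta> x \<cdot> y = ssign (i * j) *s (\<delta> y \<cdot> x)
        \<and> ssign (i * j) *s (\<delta> y \<cdot> x) = - (ssign (d * (i + j)) *s (x \<cdot> D y))"
    and adm3: "\<lbrakk>x \<in> H i; y \<in> H j\<rbrakk> \<Longrightarrow> D (x \<cdot> y) = ssign (d * j) *s (D x \<cdot> y)"
    and adm4: "x \<in> H i \<Longrightarrow>
          \<delta> (\<delta> x) = ssign d *s \<delta> (\<delta> x)
        \<and> ssign d *s \<delta> (\<delta> x) = - D (D x)
        \<and> - D (D x) = (1 + ssign d) *s (a0 \<cdot> x)"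
    and adm5: "x \<in> H i \<Longrightarrow>
          \<delta> (D x) = - (ssign d *s D (\<delta> x))
        \<and> - (ssign d *s D (\<delta> x)) = ssign (d * i) *s (x \<cdot> a0)
        \<and> ssign (d * i) *s (x \<cdot> a0) = - (ssign (d * (i + d)) *s (a0 \<cdot> x))"
    and adm6: "\<delta> a0 = 0 \<and> D a0 = 0"

text \<open>
  The data \<open>(\<delta>, \<delta>\<^sup>*, a0)\<close> of an even double extension, with \<open>D\<close> in the role of the adjoint
  \<open>\<delta>\<^sup>*\<close>. The scalar \<open>\<alpha>\<close> in the product below is unconstrained.
\<close>

locale even_double_extension_data =
  quadratic_zinbiel_superalgebra scale H mult B + admissible_triple scale H mult 0 \<delta> D a0
  for scale :: "'k::field \<Rightarrow> 'v::ab_group_add \<Rightarrow> 'v" (infixr "*s" 75)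
    and H :: "bit \<Rightarrow> 'v set"
    and mult :: "'v \<Rightarrow> 'v \<Rightarrow> 'v" (infixl "\<cdot>" 70)
    and B :: "'v \<Rightarrow> 'v \<Rightarrow> 'k"
    and \<delta> D :: "'v \<Rightarrow> 'v" and a0 :: 'v +
  assumes adjoint: "\<lbrakk>x \<in> total H; y \<in> total H\<rbrakk> \<Longrightarrow> B (\<delta> x) y = B x (D y)"
    and \<delta>_annihilator: "\<delta> ` total H \<subseteq> annihilator H mult"
    and \<delta>_square: "\<delta> ` square = {0}"
    and compositions: "x \<in> total H \<Longrightarrow> \<delta> (\<delta> x) = 0 \<and> \<delta> (D x) = 0 \<and> D (\<delta> x) = 0"
    and a0_isotropic: "B a0 a0 = 0"

text \<open>
  The triple \<open>(a, x, b)\<close> stands for \<open>a d\<^sup>* + x + b d\<close>, with \<open>x\<close> in \<open>H\<close>. The product is the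
  bilinear expansion of \<open>d d = a0 + \<alpha> d\<^sup>*\<close>, \<open>d y = \<delta> y + B y a0 d\<^sup>*\<close>,
  \<open>x y = x \<cdot> y + B (\<delta> x) y d\<^sup>*\<close>, \<open>x d = D x + B x a0 d\<^sup>*\<close>, with \<open>d\<^sup>*\<close> annihilating everything.
\<close>

definition dext_scale ::
  "('k::field \<Rightarrow> 'v \<Rightarrow> 'v) \<Rightarrow> 'k \<Rightarrow> 'k \<times> 'v \<times> 'k \<Rightarrow> 'k \<times> 'v \<times> 'k" where
  "dext_scale scale = (\<lambda>c (a, x, b). (c * a, scale c x, c * b))"

definition dext_part :: "(bit \<Rightarrow> 'v set) \<Rightarrow> bit \<Rightarrow> ('k::field \<times> 'v \<times> 'k) set" where
  "dext_part H i = (if i = 0 then UNIV \<times> H 0 \<times> UNIV else {0} \<times> H 1 \<times> {0})"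

definition dext_mult ::
  "('k::field \<Rightarrow> 'v::ab_group_add \<Rightarrow> 'v) \<Rightarrow> ('v \<Rightarrow> 'v \<Rightarrow> 'v) \<Rightarrow> ('v \<Rightarrow> 'v \<Rightarrow> 'k) \<Rightarrow>
   ('v \<Rightarrow> 'v) \<Rightarrow> ('v \<Rightarrow> 'v) \<Rightarrow> 'v \<Rightarrow> 'k \<Rightarrow> 'k \<times> 'v \<times> 'k \<Rightarrow> 'k \<times> 'v \<times> 'k \<Rightarrow> 'k \<times> 'v \<times> 'k"
  where
  "dext_mult scale mult B \<delta> D a0 \<alpha> = (\<lambda>(a, x, b) (a', y, b').
     (B (\<delta> x) y + b * B y a0 + b' * B x a0 + b * b' * \<alpha>,
      mult x y + scale b (\<delta> y) + scale b' (D x) + scale (b * b') a0,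
      0))"

definition dext_form :: "('v \<Rightarrow> 'v \<Rightarrow> 'k::field) \<Rightarrow> 'k \<times> 'v \<times> 'k \<Rightarrow> 'k \<times> 'v \<times> 'k \<Rightarrow> 'k" where
  "dext_form B = (\<lambda>(a, x, b) (a', y, b'). B x y + a * b' + b * a')"

text \<open>
  Isomorphisms preserve degrees and are not required to respect any form.
\<close>

definition superalgebra_isomorphic ::
  "('k \<Rightarrow> 'v::ab_group_add \<Rightarrow> 'v) \<Rightarrow> (bit \<Rightarrow> 'v set) \<Rightarrow> ('v \<Rightarrow> 'v \<Rightarrow> 'v) \<Rightarrow>
   ('k \<Rightarrow> 'w::ab_group_add \<Rightarrow> 'w) \<Rightarrow> (bit \<Rightarrow> 'w set) \<Rightarrow> ('w \<Rightarrow> 'w \<Rightarrow> 'w) \<Rightarrow> bool" where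
  "superalgebra_isomorphic s A mult s' A' mult' \<longleftrightarrow>
     (\<exists>f. linear_on s (total A) s' f \<and> bij_betw f (total A) (total A') \<and>
          (\<forall>i. f ` A i = A' i) \<and>
          (\<forall>x\<in>total A. \<forall>y\<in>total A. f (mult x y) = mult' (f x) (f y)))"

end

theory Submission
  imports Defs
begin

text \<open>
  The values \<open>B ((x y) z) w = B (x y) (z w)\<close> depend, up to Koszul signs, only on the
  matching \<open>{{x, w}, {y, z}}\<close>, and the Zinbiel identity says that one of the three matchings
  is the sum of the two others. Applying this to all matchings makes twice each value vanish, so all
  products of three elements are zero. If the even annihilator contains an isotropic \<open>e \<noteq> 0\<close>,
  complete it to a hyperbolic pair \<open>(e, d)\<close>; its orthogonal complement \<open>H\<close>, with all
  products projected to \<open>H\<close>, is the base of the double extension, the admissibility conditions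
  holding because triple products vanish. If the even annihilator is
  anisotropic, then even products, being isotropic elements of the annihilator, are zero, and so are
  all others; as isomorphisms ignore the form, it may be replaced by one for which a hyperbolic pair
  exists.
\<close>

section \<open>Degrees, graded subspaces and bilinear products\<close>

text \<open>A case distinction in the shape of an induction rule, so that \<open>induct\<close> puts
  the constant degree into the inserted facts as well as into the goal.\<close>

lemma bit_induct: "P 0 \<Longrightarrow> P 1 \<Longrightarrow> P (b :: bit)"
  by (cases b) auto

lemma subset_total: "0 \<in> A 0 \<Longrightarrow> 0 \<in> A 1 \<Longrightarrow> A i \<subseteq> total A"
  unfolding total_def by (cases i) (fastforce intro: exI[of _ 0])+

context superspace
begin

lemma zero_part [simp]: "0 \<in> A i"
  using subspace_part subspace_0 by blast

lemma part_total: "x \<in> A i \<Longrightarrow> x \<in> total A"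
  using subset_total[of A i] by auto

lemma total_cases:
  assumes "x \<in> total A"
  obtains x0 x1 where "x0 \<in> A 0" "x1 \<in> A 1" "x = x0 + x1"
  using assms unfolding total_def by blast

lemma subspace_total: "subspace (total A)"
  unfolding total_def by (intro subspace_sums subspace_part)

lemmas total_closed =
  subspace_0[OF subspace_total] subspace_add[OF subspace_total] subspace_diff[OF subspace_total]
  subspace_scale[OF subspace_total] subspace_neg[OF subspace_total]

lemmas part_closed =
  subspace_add[OF subspace_part] subspace_diff[OF subspace_part]
  subspace_scale[OF subspace_part] subspace_neg[OF subspace_part]

text \<open>The ambient space may be infinite-dimensional; finiteness comes from the finite set
  spanning \<open>total A\<close>, which bounds every independent subset.\<close>

lemma finite_spanning_subset:
  assumes "subspace W" "W \<subseteq> total A"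
  obtains S where "finite S" "independent S" "span S = W" "card S = dim W"
proof -
  obtain S where S: "S \<subseteq> W" "independent S" "W \<subseteq> span S" "card S = dim W"
    using basis_exists by blast
  obtain T where "finite T" "span T = total A"
    using finite_dimensional by blast
  then have "finite S"
    using independent_span_bound[of T S] S assms by auto
  then show thesis
    using that S span_subspace[of S W] assms by blast
qed

end

context superalgebra
begin

lemma mult_add:
  assumes "x \<in> total A" "y \<in> total A" "z \<in> total A"
  shows mult_add_left: "(x + y) \<cdot> z = x \<cdot> z + y \<cdot> z"
    and mult_add_right: "z \<cdot> (x + y) = z \<cdot> x + z \<cdot> y"
  using bilinear_mult assms unfolding bilinear_on_def linear_on_def by blast+

lemma mult_scale:
  assumes "x \<in> total A" "z \<in> total A"
  shows mult_scale_left: "(c *s x) \<cdot> z = c *s (x \<cdot> z)"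
    and mult_scale_right: "z \<cdot> (c *s x) = c *s (z \<cdot> x)"
  using bilinear_mult assms unfolding bilinear_on_def linear_on_def by blast+

lemmas mult_linear = mult_add mult_scale

lemma mult_zero: assumes "x \<in> total A" shows "0 \<cdot> x = 0" "x \<cdot> 0 = 0"
  using mult_scale_left[of x x 0] mult_scale_right[of x x 0] assms by simp_all

lemma mult_total:
  assumes "x \<in> total A" "y \<in> total A"
  shows "x \<cdot> y \<in> total A"
proof -
  obtain x0 x1 where x: "x0 \<in> A 0" "x1 \<in> A 1" "x = x0 + x1"
    using assms(1) by (rule total_cases)
  obtain y0 y1 where y: "y0 \<in> A 0" "y1 \<in> A 1" "y = y0 + y1"
    using assms(2) by (rule total_cases)
  have "x \<cdot> y = x0 \<cdot> y0 + x0 \<cdot> y1 + (x1 \<cdot> y0 + x1 \<cdot> y1)"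
    using x y by (simp add: mult_add_left mult_add_right total_closed part_total)
  then show ?thesis
    using x y mult_graded part_total by (metis total_closed(2))
qed

end

section \<open>Calculus with the invariant form\<close>

context quadratic_zinbiel_superalgebra
begin

lemma form_add:
  assumes "x \<in> total A" "y \<in> total A" "z \<in> total A"
  shows form_add_left: "B (x + y) z = B x z + B y z"
    and form_add_right: "B z (x + y) = B z x + B z y"
  using bilinear_form assms unfolding bilinear_on_def linear_on_def by blast+

lemma form_scale:
  assumes "x \<in> total A" "z \<in> total A"
  shows form_scale_left: "B (c *s x) z = c * B x z"
    and form_scale_right: "B z (c *s x) = c * B z x"
  using bilinear_form assms unfolding bilinear_on_def linear_on_def by blast+

lemmas form_linear = form_add form_scale

lemma form_zero: assumes "x \<in> total A" shows "B 0 x = 0" "B x 0 = 0"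
  using form_scale_left[of x x 0] form_scale_right[of x x 0] assms by simp_all

lemma form_diff:
  assumes "x \<in> total A" "y \<in> total A" "z \<in> total A"
  shows form_diff_left: "B (x - y) z = B x z - B y z"
    and form_diff_right: "B z (x - y) = B z x - B z y"
  using form_add_left[of "x - y" y z] form_add_right[of "x - y" y z] assms
  by (simp_all add: total_closed)

text \<open>Between even elements the sign is 1, and the odd part of \<open>y\<close> pairs to zero
  with \<open>x\<close> on either side.\<close>

lemma form_commute_even:
  assumes "x \<in> A 0" "y \<in> total A"
  shows "B x y = B y x"
proof -
  obtain y0 y1 where y: "y0 \<in> A 0" "y1 \<in> A 1" "y = y0 + y1"
    using assms(2) by (rule total_cases)
  then show ?thesis
    using assms even_form[of x y1] supersymmetric[of x 0 y0 0]
    by (simp add: form_add_left form_add_right part_total ssign_def)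
qed

section \<open>Vanishing of all triple products\<close>

text \<open>Invariance splits the four factors into two pairs, which supersymmetry exchanges. In the
  second part it isolates \<open>x\<close>, and moving \<open>x\<close> to the end makes the nested
  product a left-nested one.\<close>

lemma triple_form_symmetry:
  assumes "x \<in> A i" "y \<in> A j" "z \<in> A k" "w \<in> A l"
  shows "B ((x \<cdot> y) \<cdot> z) w = ssign ((i + j) * (k + l)) * B ((z \<cdot> w) \<cdot> x) y"
    and "B (x \<cdot> (y \<cdot> z)) w = ssign (i * (j + k + l)) * B ((y \<cdot> z) \<cdot> w) x"
proof -
  note t = assms[THEN part_total]
  have "B ((x \<cdot> y) \<cdot> z) w = B (x \<cdot> y) (z \<cdot> w)"
    using invariant t mult_total by blast
  also have "\<dots> = ssign ((i + j) * (k + l)) * B (z \<cdot> w) (x \<cdot> y)"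
    by (intro supersymmetric mult_graded assms)
  also have "B (z \<cdot> w) (x \<cdot> y) = B ((z \<cdot> w) \<cdot> x) y"
    using invariant t mult_total by simp
  finally show "B ((x \<cdot> y) \<cdot> z) w = ssign ((i + j) * (k + l)) * B ((z \<cdot> w) \<cdot> x) y" .
  have "B (x \<cdot> (y \<cdot> z)) w = B x ((y \<cdot> z) \<cdot> w)"
    using invariant t mult_total by blast
  also have "\<dots> = ssign (i * (j + k + l)) * B ((y \<cdot> z) \<cdot> w) x"
    by (intro supersymmetric mult_graded assms)
  finally show "B (x \<cdot> (y \<cdot> z)) w = ssign (i * (j + k + l)) * B ((y \<cdot> z) \<cdot> w) x" .
qed

text \<open>The left Zinbiel identity paired with \<open>w\<close>; its right-nested terms are
  rewritten so that only left-nested products occur.\<close>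

lemma triple_form_left:
  assumes "left_zinbiel_superalgebra scale A mult"
    and "x \<in> A i" "y \<in> A j" "z \<in> A k" "w \<in> A l"
  shows "B ((x \<cdot> y) \<cdot> z) w = ssign (i * (j + k + l)) *
           (B ((y \<cdot> z) \<cdot> w) x + ssign (j * k) * B ((z \<cdot> y) \<cdot> w) x)"
proof -
  interpret left_zinbiel_superalgebra scale A mult by fact
  note t = assms(2-)[THEN part_total]
  have "B ((x \<cdot> y) \<cdot> z) w = B (x \<cdot> (y \<cdot> z)) w + ssign (j * k) * B (x \<cdot> (z \<cdot> y)) w"
    using left_zinbiel[OF assms(2-4)] t
    by (simp add: form_add_left form_scale_left total_closed mult_total)
  then show ?thesis
    using triple_form_symmetry(2)[OF assms(2-5)] triple_form_symmetry(2)[OF assms(2) assms(4,3,5)]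
    by (simp only: add.commute[of k j] distrib_left mult.left_commute)
qed

lemma triple_form_right:
  assumes "right_zinbiel_superalgebra scale A mult"
    and "x \<in> A i" "y \<in> A j" "z \<in> A k" "w \<in> A l"
  shows "ssign (i * (j + k + l)) * B ((y \<cdot> z) \<cdot> w) x =
           B ((x \<cdot> y) \<cdot> z) w + ssign (i * j) * B ((y \<cdot> x) \<cdot> z) w"
proof -
  interpret right_zinbiel_superalgebra scale A mult by fact
  note t = assms(2-)[THEN part_total]
  have "B (x \<cdot> (y \<cdot> z)) w = B ((x \<cdot> y) \<cdot> z) w + ssign (i * j) * B ((y \<cdot> x) \<cdot> z) w"
    using right_zinbiel[OF assms(2-4)] t
    by (simp add: form_add_left form_scale_left total_closed mult_total)
  then show ?thesis
    using triple_form_symmetry(2)[OF assms(2-5)] by simp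
qed

text \<open>
  The goals below are differences because the method \<open>algebra\<close> does not recognise the ring in
  equations between atoms.
\<close>

lemma triple_form_swap_left:
  assumes L: "left_zinbiel_superalgebra scale A mult"
    and x: "x \<in> A i" and y: "y \<in> A j" and z: "z \<in> A k" and w: "w \<in> A l"
  shows "B ((x \<cdot> y) \<cdot> z) w = ssign (j * k) * B ((x \<cdot> z) \<cdot> y) w"
proof -
  have "B ((x \<cdot> y) \<cdot> z) w - ssign (j * k) * B ((x \<cdot> z) \<cdot> y) w = 0"
    \<comment> \<open>Exchanging \<open>y\<close> and \<open>z\<close> reproduces the right-hand
      side of the paired identity up to the Koszul sign of \<open>y\<close> and
      \<open>z\<close>.\<close>
    by (insert triple_form_left[OF L x y z w] triple_form_left[OF L x z y w],
        (induct i rule: bit_induct; induct j rule: bit_induct; induct k rule: bit_induct;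
          induct l rule: bit_induct; simp (no_asm_use) add: ssign_def del: right_minus_eq; algebra?))
  then show ?thesis by simp
qed

text \<open>Let p, q, r be the values, up to signs, of the matchings {{x, y}, {z, w}}, {{x, w}, {y,
  z}}, {{x, z}, {y, w}}. The identity for \<open>x\<close>, \<open>y\<close>, \<open>z\<close> reads
  q = p + r and the one for \<open>y\<close>, \<open>z\<close>, \<open>w\<close> reads p = q + r, so
  2r = 0.\<close>

lemma triple_form_eq_0_left:
  assumes two: "(2::'k) \<noteq> 0"
    and L: "left_zinbiel_superalgebra scale A mult"
    and x: "x \<in> A i" and y: "y \<in> A j" and z: "z \<in> A k" and w: "w \<in> A l"
  shows "B ((z \<cdot> y) \<cdot> w) x = 0"
proof -
  have "2 * B ((z \<cdot> y) \<cdot> w) x = 0"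
    by (insert triple_form_left[OF L x y z w] triple_form_left[OF L y z w x]
      triple_form_swap_left[OF L w z x y]
      triple_form_symmetry(1)[OF x y z w] triple_form_symmetry(1)[OF w x z y],
      (induct i rule: bit_induct; induct j rule: bit_induct; induct k rule: bit_induct;
        induct l rule: bit_induct; simp (no_asm_use) add: ssign_def; algebra?))
  then show ?thesis using two by simp
qed

text \<open>Once the pairs are exchanged, both sides are left-hand sides of the paired right Zinbiel
  identity, and the corresponding right-hand sides differ only by the Koszul sign of
  \<open>y\<close> and \<open>z\<close>.\<close>

lemma triple_form_swap_right:
  assumes R: "right_zinbiel_superalgebra scale A mult"
    and x: "x \<in> A i" and y: "y \<in> A j" and z: "z \<in> A k" and w: "w \<in> A l"
  shows "B ((x \<cdot> y) \<cdot> z) w = ssign (j * k) * B ((x \<cdot> z) \<cdot> y) w"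
proof -
  have "B ((x \<cdot> y) \<cdot> z) w - ssign (j * k) * B ((x \<cdot> z) \<cdot> y) w = 0"
    by (subst triple_form_symmetry(1)[OF x y z w], subst triple_form_symmetry(1)[OF x z y w],
        insert triple_form_right[OF R y z w x] triple_form_right[OF R z y w x],
        (induct i rule: bit_induct; induct j rule: bit_induct; induct k rule: bit_induct;
          induct l rule: bit_induct; simp (no_asm_use) add: ssign_def del: right_minus_eq; algebra))
  then show ?thesis by simp
qed

text \<open>Exchanging the pairs brings \<open>x\<close> and \<open>w\<close> into the two inner
  positions, where the previous swap applies. With both swaps, only the matching {{x, w}, {y, z}}
  matters.\<close>

lemma triple_form_swap_outer_right:
  assumes R: "right_zinbiel_superalgebra scale A mult"
    and x: "x \<in> A i" and y: "y \<in> A j" and z: "z \<in> A k" and w: "w \<in> A l"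
  shows "B ((x \<cdot> y) \<cdot> z) w = ssign (i * l + (i + l) * (j + k)) * B ((w \<cdot> y) \<cdot> z) x"
  by (subst triple_form_symmetry(1)[OF x y z w], subst triple_form_swap_right[OF R z w x y],
      subst triple_form_symmetry(1)[OF z x w y])
    (cases i; cases j; cases k; cases l; simp add: ssign_def)

text \<open>With p, q, r for the matchings {{x, y}, {z, w}}, {{x, w}, {y, z}}, {{x, z}, {y, w}} and
  up to signs, the identity for \<open>x\<close>, \<open>y\<close>, \<open>z\<close> reads p = q + r
  and the one for \<open>x\<close>, \<open>w\<close>, \<open>z\<close> reads q = p + r. Hence 2r =
  0.\<close>

lemma triple_form_eq_0_right:
  assumes two: "(2::'k) \<noteq> 0"
    and R: "right_zinbiel_superalgebra scale A mult"
    and x: "x \<in> A i" and y: "y \<in> A j" and z: "z \<in> A k" and w: "w \<in> A l"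
  shows "B ((y \<cdot> x) \<cdot> z) w = 0"
proof -
  have "2 * B ((y \<cdot> x) \<cdot> z) w = 0"
    by (insert triple_form_right[OF R x y z w] triple_form_right[OF R x w z y]
      triple_form_swap_right[OF R x y z w] triple_form_swap_outer_right[OF R x z y w]
      triple_form_swap_right[OF R x w z y] triple_form_swap_outer_right[OF R x z w y]
      triple_form_swap_outer_right[OF R y x z w],
      (induct i rule: bit_induct; induct j rule: bit_induct; induct k rule: bit_induct;
        induct l rule: bit_induct; simp (no_asm_use) add: ssign_def; algebra?))
  then show ?thesis using two by simp
qed

lemma triple_form_eq_0:
  assumes two: "(2::'k) \<noteq> 0"
    and x: "x \<in> A i" and y: "y \<in> A j" and z: "z \<in> A k" and w: "w \<in> A l"
  shows "B ((x \<cdot> y) \<cdot> z) w = 0"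
  using left_or_right_zinbiel triple_form_eq_0_left[OF two _ w y x z]
    triple_form_eq_0_right[OF two _ y x z w] by blast

lemma nondegenerate_homogeneous:
  assumes "x \<in> total A" "\<And>i w. w \<in> A i \<Longrightarrow> B x w = 0"
  shows "x = 0"
proof (rule nondegenerate[OF assms(1)], intro ballI)
  fix w assume "w \<in> total A"
  then obtain w0 w1 where "w0 \<in> A 0" "w1 \<in> A 1" "w = w0 + w1"
    by (rule total_cases)
  then show "B x w = 0"
    using assms by (simp add: form_add_right part_total)
qed

lemma triple_product_eq_0:
  assumes two: "(2::'k) \<noteq> 0" and t: "x \<in> total A" "y \<in> total A" "z \<in> total A"
  shows "(x \<cdot> y) \<cdot> z = 0" and "x \<cdot> (y \<cdot> z) = 0"
proof -
  have hom: "(u \<cdot> v) \<cdot> w = 0" "u \<cdot> (v \<cdot> w) = 0"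
    if "u \<in> A i" "v \<in> A j" "w \<in> A k" for u v w i j k
  proof -
    note t = that[THEN part_total]
    show "(u \<cdot> v) \<cdot> w = 0"
      using t that triple_form_eq_0[OF two] by (intro nondegenerate_homogeneous mult_total)
    show "u \<cdot> (v \<cdot> w) = 0"
      using t that triple_form_symmetry(2) triple_form_eq_0[OF two]
      by (intro nondegenerate_homogeneous mult_total) simp_all
  qed
  obtain x0 x1 y0 y1 z0 z1 where d: "x0 \<in> A 0" "x1 \<in> A 1" "x = x0 + x1"
      "y0 \<in> A 0" "y1 \<in> A 1" "y = y0 + y1" "z0 \<in> A 0" "z1 \<in> A 1" "z = z0 + z1"
    using t by (metis total_cases)
  then show "(x \<cdot> y) \<cdot> z = 0" "x \<cdot> (y \<cdot> z) = 0"
    by (simp_all add: mult_add_left mult_add_right total_closed part_total mult_total hom)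
qed

end

section \<open>The orthogonal complement of a hyperbolic pair\<close>

text \<open>Here \<open>e\<close> is the future \<open>d\<^sup>*\<close>, which annihilates
  everything, and \<open>d\<close> the future generator of the added line.\<close>

locale hyperbolic_pair = quadratic_zinbiel_superalgebra scale A mult B
  for scale :: "'k::field \<Rightarrow> 'v::ab_group_add \<Rightarrow> 'v" (infixr "*s" 75)
    and A :: "bit \<Rightarrow> 'v set"
    and mult :: "'v \<Rightarrow> 'v \<Rightarrow> 'v" (infixl "\<cdot>" 70)
    and B :: "'v \<Rightarrow> 'v \<Rightarrow> 'k" +
  fixes e d :: 'v
  assumes char_not_2: "(2::'k) \<noteq> 0"
    and e_annihilator: "e \<in> annihilator A mult"
    and e_even: "e \<in> A 0" and d_even: "d \<in> A 0"
    and form_e_e: "B e e = 0" and form_e_d: "B e d = 1" and form_d_d: "B d d = 0"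
begin

definition H :: "bit \<Rightarrow> 'v set" where
  "H i = {x \<in> A i. B e x = 0 \<and> B d x = 0}"

text \<open>The orthogonal projection onto the complement: as \<open>e\<close> and \<open>d\<close>
  are isotropic with pairing 1, the coefficient of \<open>e\<close> is the pairing with
  \<open>d\<close> and vice versa.\<close>

definition proj :: "'v \<Rightarrow> 'v" where
  "proj x = x - (B d x *s e + B e x *s d)"

definition multH :: "'v \<Rightarrow> 'v \<Rightarrow> 'v" where "multH x y = proj (x \<cdot> y)"
definition \<delta> :: "'v \<Rightarrow> 'v" where "\<delta> x = proj (d \<cdot> x)"
definition D :: "'v \<Rightarrow> 'v" where "D x = proj (x \<cdot> d)"
definition a0 :: 'v where "a0 = proj (d \<cdot> d)"

lemma e_total [simp]: "e \<in> total A" and d_total [simp]: "d \<in> total A"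
  using e_even d_even part_total by auto

lemma form_d_e: "B d e = 1"
  using form_commute_even[OF d_even, of e] form_e_d by simp

lemma e_mult: "x \<in> total A \<Longrightarrow> e \<cdot> x = 0" "x \<in> total A \<Longrightarrow> x \<cdot> e = 0"
  using e_annihilator unfolding annihilator_def by auto

text \<open>Invariance turns the value into \<open>B (e \<cdot> x) y\<close>. Thus products have no
  \<open>d\<close>-component.\<close>

lemma form_e_mult: "x \<in> total A \<Longrightarrow> y \<in> total A \<Longrightarrow> B e (x \<cdot> y) = 0"
  using invariant[of e x y] by (simp add: e_mult form_zero)

text \<open>The complement is graded: odd elements are orthogonal to the even \<open>e\<close> and
  \<open>d\<close> anyway, so the two conditions only concern the even component.\<close>

lemma total_H: "total H = {x \<in> total A. B e x = 0 \<and> B d x = 0}"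
proof (intro equalityI subsetI)
  fix x assume "x \<in> total H"
  then show "x \<in> {x \<in> total A. B e x = 0 \<and> B d x = 0}"
    unfolding total_def[of H] H_def
    by (auto simp: form_add_right part_total intro!: total_closed)
next
  fix x assume x: "x \<in> {x \<in> total A. B e x = 0 \<and> B d x = 0}"
  then obtain x0 x1 where *: "x0 \<in> A 0" "x1 \<in> A 1" "x = x0 + x1"
    using total_cases by blast
  moreover have "B e x1 = 0" "B d x1 = 0"
    using even_form e_even d_even * by blast+
  moreover from this have "B e x0 = 0" "B d x0 = 0"
    using x * by (simp_all add: form_add_right part_total)
  ultimately show "x \<in> total H"
    unfolding total_def[of H] H_def by blast
qed

lemma in_total_H:
  assumes "x \<in> total H"
  shows "x \<in> total A" "B e x = 0" "B d x = 0" "B x e = 0" "B x d = 0"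
  using assms form_commute_even[OF e_even, of x] form_commute_even[OF d_even, of x]
  unfolding total_H by auto

lemma part_H: "x \<in> H i \<Longrightarrow> x \<in> A i"
  unfolding H_def by blast

lemma part_total_H: "x \<in> H i \<Longrightarrow> x \<in> total H"
  unfolding total_H H_def using part_total by blast

lemma subspace_H: "subspace (H i)"
  unfolding subspace_def H_def
  by (auto simp: form_zero form_add_right form_scale_right part_total part_closed)

lemma proj_part:
  assumes "x \<in> A i"
  shows "proj x \<in> H i"
proof -
  have t: "x \<in> total A" using assms by (rule part_total)
  have "B e (proj x) = 0" "B d (proj x) = 0"
    using t unfolding proj_def
    by (simp_all add: form_diff_right form_add_right form_scale_right total_closed
        form_e_e form_e_d form_d_d form_d_e)
  moreover have "proj x \<in> A i"
  proof (cases "i = 0")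
    case True
    then show ?thesis using assms e_even d_even unfolding proj_def by (simp add: part_closed)
  next
    case False
    then have "B e x = 0" "B d x = 0"
      using assms even_form e_even d_even by auto
    then show ?thesis using assms unfolding proj_def by simp
  qed
  ultimately show ?thesis unfolding H_def by blast
qed

lemma proj_add:
  assumes "x \<in> total A" "y \<in> total A"
  shows "proj (x + y) = proj x + proj y"
  using assms unfolding proj_def by (simp add: form_add_right scale_left_distrib)

lemma proj_scale: "x \<in> total A \<Longrightarrow> proj (c *s x) = c *s proj x"
  unfolding proj_def
  by (simp add: form_scale_right scale_right_distrib scale_right_diff_distrib)

lemmas proj_linear = proj_add proj_scale

lemma proj_total:
  assumes "x \<in> total A"
  shows "proj x \<in> total H"
proof -
  obtain x0 x1 where "x0 \<in> A 0" "x1 \<in> A 1" "x = x0 + x1"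
    using assms by (rule total_cases)
  then show ?thesis
    using proj_part unfolding total_def[of H] by (auto simp: proj_add part_total)
qed

lemma form_proj:
  assumes "x \<in> total A" "y \<in> total H"
  shows "B (proj x) y = B x y" "B y (proj x) = B y x"
  using assms in_total_H[of y] unfolding proj_def
  by (simp_all add: form_diff_left form_diff_right form_add_left form_add_right
      form_scale_left form_scale_right total_closed)

text \<open>A product differs from its projection only by a multiple of \<open>e\<close>, which
  annihilates everything; so the vanishing of triple products survives the projection.\<close>

lemma proj_mult_eq_0:
  assumes "x \<in> total A" "y \<in> total A" "z \<in> total A"
  shows "proj (x \<cdot> y) \<cdot> z = 0" "z \<cdot> proj (x \<cdot> y) = 0"
proof -
  have p: "x \<cdot> y = proj (x \<cdot> y) + B d (x \<cdot> y) *s e"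
    using form_e_mult assms unfolding proj_def by simp
  have t: "proj (x \<cdot> y) \<in> total A"
    using in_total_H(1)[OF proj_total] mult_total assms by blast
  have "(x \<cdot> y) \<cdot> z = proj (x \<cdot> y) \<cdot> z" "z \<cdot> (x \<cdot> y) = z \<cdot> proj (x \<cdot> y)"
    using t assms by (subst p, simp add: mult_linear e_mult total_closed)+
  then show "proj (x \<cdot> y) \<cdot> z = 0" "z \<cdot> proj (x \<cdot> y) = 0"
    using triple_product_eq_0[OF char_not_2] assms by simp_all
qed

lemma proj_0 [simp]: "proj 0 = 0"
  unfolding proj_def by (simp add: form_zero)

text \<open>Here and in the next lemmas, \<open>\<delta>\<close> and \<open>D\<close> contribute one
  factor \<open>d\<close> and \<open>a0\<close> contributes two, so that every expression is a
  projected product of three elements of \<open>A\<close>.\<close>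

lemma H_triple_eq_0:
  assumes "x \<in> total A" "y \<in> total A" "z \<in> total A"
  shows "multH (multH x y) z = 0" "multH z (multH x y) = 0"
  unfolding multH_def using assms by (simp_all add: proj_mult_eq_0)

lemma H_double_eq_0:
  assumes "x \<in> total A" "z \<in> total A"
  shows "multH (\<delta> x) z = 0" "multH z (\<delta> x) = 0" "multH (D x) z = 0" "multH z (D x) = 0"
    "\<delta> (multH x z) = 0" "D (multH x z) = 0"
  unfolding multH_def \<delta>_def D_def using assms by (simp_all add: proj_mult_eq_0)

lemma H_single_eq_0:
  assumes "x \<in> total A"
  shows "multH a0 x = 0" "multH x a0 = 0"
    "\<delta> (\<delta> x) = 0" "\<delta> (D x) = 0" "D (\<delta> x) = 0" "D (D x) = 0"
  unfolding multH_def \<delta>_def D_def a0_def using assms by (simp_all add: proj_mult_eq_0)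

lemma H_a0_eq_0: "\<delta> a0 = 0" "D a0 = 0"
  unfolding \<delta>_def D_def a0_def by (simp_all add: proj_mult_eq_0)

lemmas H_products_eq_0 = H_triple_eq_0 H_double_eq_0 H_single_eq_0 H_a0_eq_0

section \<open>The quadratic structure and the admissible triple on the complement\<close>

lemma superspace_H: "superspace scale H"
proof
  show "subspace (H i)" for i by (rule subspace_H)
  show "H 0 \<inter> H 1 = {0}"
    using direct subspace_0[OF subspace_H] unfolding H_def by blast
  have "subspace (total H)"
    unfolding total_def by (intro subspace_sums subspace_H)
  then show "\<exists>S. finite S \<and> span S = total H"
    using finite_spanning_subset[of "total H"] in_total_H(1) by (metis subsetI)
qed

lemma bilinear_multH: "bilinear_on scale (total H) scale multH"
  unfolding bilinear_on_def linear_on_def multH_def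
  by (simp add: in_total_H mult_linear proj_linear mult_total)

lemma superalgebra_H: "superalgebra scale H multH"
proof (intro superalgebra.intro superspace_H superalgebra_axioms.intro bilinear_multH)
  show "multH x y \<in> H (i + j)" if "x \<in> H i" "y \<in> H j" for x y i j
    unfolding multH_def using that by (intro proj_part mult_graded part_H)
qed

lemma total_H_total: "x \<in> H i \<Longrightarrow> x \<in> total A"
  using part_total_H in_total_H by blast

lemma symmetric_H: "symmetric_zinbiel_superalgebra scale H multH"
proof -
  interpret Hs: superalgebra scale H multH by (rule superalgebra_H)
  show ?thesis
    by unfold_locales (simp_all add: H_products_eq_0 total_H_total)
qed

lemma quadratic_H: "quadratic_zinbiel_superalgebra scale H multH B"
proof -
  interpret Hs: symmetric_zinbiel_superalgebra scale H multH by (rule symmetric_H)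
  show ?thesis
  proof
    show "left_zinbiel_superalgebra scale H multH \<or> right_zinbiel_superalgebra scale H multH"
      by (simp add: Hs.left_zinbiel_superalgebra_axioms)
    show "bilinear_on scale (total H) (*) B"
      unfolding bilinear_on_def linear_on_def by (simp add: in_total_H form_linear)
    show "x = 0" if x: "x \<in> total H" "\<forall>y\<in>total H. B x y = 0" for x
    proof (rule nondegenerate)
      show "x \<in> total A" using x in_total_H by blast
      \<comment> \<open>As \<open>x\<close> lies in the complement, pairing it with \<open>y\<close>
        is the same as pairing it with \<open>proj y\<close>.\<close>
      show "\<forall>y\<in>total A. B x y = 0"
        using form_proj(2)[OF _ x(1)] x(2) proj_total by metis
    qed
    show "B x y = ssign (i * j) * B y x" if "x \<in> H i" "y \<in> H j" for x y i j
      using that part_H supersymmetric by blast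
    show "B (multH x y) z = B x (multH y z)"
      if "x \<in> total H" "y \<in> total H" "z \<in> total H" for x y z
      using that invariant unfolding multH_def by (simp add: form_proj in_total_H mult_total)
    show "B x y = 0 \<and> B y x = 0" if "x \<in> H 0" "y \<in> H 1" for x y
      using that part_H even_form by blast
  qed
qed

lemma a0_even: "a0 \<in> H 0"
  unfolding a0_def using proj_part mult_graded[OF d_even d_even] by simp

lemma admissible_H: "admissible_triple scale H multH 0 \<delta> D a0"
proof -
  interpret Hs: symmetric_zinbiel_superalgebra scale H multH by (rule symmetric_H)
  show ?thesis
  proof
    show "linear_on scale (total H) scale \<delta>" "linear_on scale (total H) scale D"
      unfolding linear_on_def \<delta>_def D_def
      by (simp_all add: in_total_H mult_linear proj_linear mult_total)
    show "\<delta> x \<in> H (i + 0)" "D x \<in> H (i + 0)" if "x \<in> H i" for x i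
      using that d_even proj_part mult_graded[of x i d 0] mult_graded[of d 0 x i] part_H
      unfolding \<delta>_def D_def by auto
    show "a0 \<in> annihilator H multH \<inter> H 0"
      unfolding annihilator_def using a0_even part_total_H
      by (auto simp: H_products_eq_0 in_total_H)
  qed (simp_all add: H_products_eq_0 total_H_total)
qed

text \<open>Both sides equal the pairing of \<open>x \<cdot> y\<close> with \<open>d\<close>, by
  invariance; no sign appears because \<open>d\<close> is even.\<close>

lemma adjoint_H:
  assumes "x \<in> total H" "y \<in> total H"
  shows "B (\<delta> x) y = B x (D y)"
proof -
  note t = in_total_H(1)[OF assms(1)] in_total_H(1)[OF assms(2)]
  have "B (\<delta> x) y = B (d \<cdot> x) y"
    unfolding \<delta>_def using assms t by (simp add: form_proj mult_total)
  also have "\<dots> = B d (x \<cdot> y)" using t invariant by simp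
  also have "\<dots> = B (x \<cdot> y) d" using t form_commute_even d_even mult_total by blast
  also have "\<dots> = B x (y \<cdot> d)" using t invariant by simp
  also have "\<dots> = B x (D y)"
    unfolding D_def using assms t by (simp add: form_proj mult_total)
  finally show ?thesis .
qed

lemma extension_data: "even_double_extension_data scale H multH B \<delta> D a0"
proof -
  interpret Hq: quadratic_zinbiel_superalgebra scale H multH B by (rule quadratic_H)
  interpret Ha: admissible_triple scale H multH 0 \<delta> D a0 by (rule admissible_H)
  have \<delta>_total: "\<delta> x \<in> total H" if "x \<in> total H" for x
    unfolding \<delta>_def using that in_total_H by (intro proj_total mult_total) auto
  show ?thesis
  proof
    show "B (\<delta> x) y = B x (D y)" if "x \<in> total H" "y \<in> total H" for x y
      using that by (rule adjoint_H)
    show "\<delta> ` total H \<subseteq> annihilator H multH"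
      unfolding annihilator_def by (auto simp: H_products_eq_0 in_total_H \<delta>_total)
    show "\<delta> ` Hq.square = {0}"
    proof -
      \<comment> \<open>The square is a span, so it lies in the kernel of \<open>\<delta>\<close> as
        soon as the products do.\<close>
      have "subspace {x \<in> total H. \<delta> x = 0}"
        using Ha.linear_\<delta> Hq.total_closed unfolding subspace_def linear_on_def
        by (auto simp: \<delta>_def mult_zero)
      then have "Hq.square \<subseteq> {x \<in> total H. \<delta> x = 0}"
        unfolding Hq.square_def
        by (intro span_minimal) (auto simp: H_products_eq_0 in_total_H Hq.mult_total)
      moreover have "0 \<in> Hq.square"
        unfolding Hq.square_def by (rule span_zero)
      ultimately show ?thesis by force
    qed
    show "\<delta> (\<delta> x) = 0 \<and> \<delta> (D x) = 0 \<and> D (\<delta> x) = 0" if "x \<in> total H" for x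
      using that by (simp add: H_products_eq_0 in_total_H)
    have a0: "a0 \<in> total H" using a0_even part_total_H by blast
    \<comment> \<open>One copy of \<open>a0\<close> may be replaced by the unprojected product;
      invariance then produces the vanishing triple product \<open>d \<cdot> a0\<close>.\<close>
    have "B a0 a0 = B (d \<cdot> d) a0"
      using form_proj(1)[OF _ a0, of "d \<cdot> d"] unfolding a0_def by (simp add: mult_total)
    also have "\<dots> = B d (d \<cdot> a0)"
      using invariant in_total_H(1)[OF a0] by simp
    also have "\<dots> = 0"
      unfolding a0_def by (simp add: proj_mult_eq_0 form_zero)
    finally show "B a0 a0 = 0" .
  qed
qed

section \<open>Dimensions of the complement\<close>

text \<open>A basis of \<open>H 0\<close> together with \<open>e\<close> and \<open>d\<close> is a
  basis of \<open>A 0\<close>: pairing with \<open>d\<close> separates \<open>e\<close> from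
  \<open>H 0\<close>, and pairing with \<open>e\<close> separates \<open>d\<close> from the span of
  both.\<close>

lemma dim_even_part: "dim (A 0) = dim (H 0) + 2"
proof -
  have "H 0 \<subseteq> total A" using total_H_total by blast
  then obtain S where S: "finite S" "independent S" "span S = H 0" "card S = dim (H 0)"
    using finite_spanning_subset[OF subspace_H] by blast
  have e: "e \<notin> span S"
    using S(3) form_d_e unfolding H_def by auto
  have d: "d \<notin> span (insert e S)"
  proof
    assume "d \<in> span (insert e S)"
    then obtain k where "d - k *s e \<in> H 0"
      using S(3) by (auto simp: span_insert)
    then have "B e (d - k *s e) = 0" unfolding H_def by blast
    then show False
      by (simp add: form_diff_right form_scale_right total_closed form_e_d form_e_e)
  qed
  have "A 0 = span (insert d (insert e S))"
  proof (intro equalityI subsetI)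
    fix x assume "x \<in> A 0"
    then have "x - B e x *s d - B d x *s e \<in> span S"
      using proj_part[of x 0] S(3) unfolding proj_def by (simp add: algebra_simps)
    then show "x \<in> span (insert d (insert e S))"
      unfolding span_insert by blast
  next
    fix x assume "x \<in> span (insert d (insert e S))"
    moreover have "insert d (insert e S) \<subseteq> A 0"
      using span_superset[of S] S(3) part_H e_even d_even by auto
    ultimately show "x \<in> A 0"
      using span_minimal subspace_part by blast
  qed
  then have "dim (A 0) = card (insert d (insert e S))"
    using S(2) e d by (simp add: dim_eq_card_independent independent_insertI)
  moreover have "e \<notin> S" "d \<notin> insert e S"
    using e d span_base by blast+
  ultimately show ?thesis using S by simp
qed

lemma odd_part: "H 1 = A 1"
  using even_form[OF e_even] even_form[OF d_even] unfolding H_def by auto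

section \<open>The isomorphism with the double extension\<close>

text \<open>Coefficient of \<open>e\<close>, component in the complement, coefficient of
  \<open>d\<close>: the order of the triples of the double extension.\<close>

definition coords :: "'v \<Rightarrow> 'k \<times> 'v \<times> 'k" where
  "coords x = (B d x, proj x, B e x)"

lemma coords_decomposition: "x = B d x *s e + proj x + B e x *s d"
  unfolding proj_def by simp

lemma coords_of_sum:
  assumes "h \<in> total H"
  shows "coords (a *s e + h + b *s d) = (a, h, b)"
proof -
  have "B d (a *s e + h + b *s d) = a" "B e (a *s e + h + b *s d) = b"
    using in_total_H[OF assms]
    by (simp_all add: form_add_right form_scale_right total_closed
        form_e_e form_e_d form_d_d form_d_e)
  then show ?thesis
    unfolding coords_def proj_def by simp
qed

lemma coords_image:
  "coords ` A i = dext_part H i"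
proof (intro equalityI subsetI)
  fix t :: "'k \<times> 'v \<times> 'k" assume "t \<in> coords ` A i"
  then show "t \<in> dext_part H i"
    using proj_part even_form[OF e_even] even_form[OF d_even]
    unfolding dext_part_def coords_def by (cases i) auto
next
  fix t :: "'k \<times> 'v \<times> 'k" assume t: "t \<in> dext_part H i"
  obtain a h b where abh: "t = (a, h, b)" by (cases t)
  have h: "h \<in> H i" "i = 0 \<or> a = 0 \<and> b = 0"
    using t abh unfolding dext_part_def by (cases i; auto)+
  have "a *s e + h + b *s d \<in> A i"
    using h part_H e_even d_even by (auto simp: part_closed)
  then show "t \<in> coords ` A i"
    using coords_of_sum[OF part_total_H[OF h(1)]] abh by (metis image_eqI)
qed

lemma total_dext: "total (dext_part H :: bit \<Rightarrow> ('k \<times> 'v \<times> 'k) set) = UNIV \<times> total H \<times> UNIV"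
proof (intro equalityI subsetI)
  fix t :: "'k \<times> 'v \<times> 'k" assume "t \<in> total (dext_part H)"
  then show "t \<in> UNIV \<times> total H \<times> UNIV"
    unfolding total_def dext_part_def by auto
next
  fix t :: "'k \<times> 'v \<times> 'k" assume "t \<in> UNIV \<times> total H \<times> UNIV"
  then obtain a x y b where t: "t = (a, x + y, b)" "x \<in> H 0" "y \<in> H 1"
    unfolding total_def by auto
  then have "t = (a, x, b) + (0, y, 0)" by simp
  then show "t \<in> total (dext_part H)"
    using t unfolding total_def dext_part_def by fastforce
qed

lemma coords_bij: "bij_betw coords (total A) (total (dext_part H))"
  unfolding bij_betw_def
proof
  show "inj_on coords (total A)"
    unfolding coords_def by (rule inj_onI) (metis coords_decomposition prod.inject)
  have "coords x \<in> total (dext_part H)" if "x \<in> total A" for x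
    using that proj_total unfolding total_dext coords_def by auto
  moreover have "t \<in> coords ` total A" if t: "t \<in> total (dext_part H)"
    for t :: "'k \<times> 'v \<times> 'k"
  proof -
    obtain a h b where h: "t = (a, h, b)" "h \<in> total H"
      using t unfolding total_dext by auto
    have "a *s e + h + b *s d \<in> total A"
      using in_total_H(1)[OF h(2)] by (simp add: total_closed)
    then show ?thesis
      using coords_of_sum[OF h(2), of a b] h(1) by (metis image_eqI)
  qed
  ultimately show "coords ` total A = total (dext_part H)"
    by blast
qed

lemma coords_linear: "linear_on scale (total A) (dext_scale scale) coords"
  unfolding linear_on_def dext_scale_def coords_def
  by (simp add: proj_linear form_add_right form_scale_right)

text \<open>Every term containing \<open>e\<close> drops out of the bilinear expansion.\<close>

lemma mult_decomposition:
  assumes "x \<in> total A" "y \<in> total A"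
  defines "x' \<equiv> proj x" and "y' \<equiv> proj y" and "b \<equiv> B e x" and "b' \<equiv> B e y"
  shows "x \<cdot> y = x' \<cdot> y' + b *s (d \<cdot> y') + b' *s (x' \<cdot> d) + (b * b') *s (d \<cdot> d)"
proof -
  have t: "x' \<in> total A" "y' \<in> total A"
    unfolding x'_def y'_def using assms proj_total in_total_H by blast+
  have "x \<cdot> y = (B d x *s e + x' + b *s d) \<cdot> (B d y *s e + y' + b' *s d)"
    unfolding x'_def y'_def b_def b'_def by (simp flip: coords_decomposition)
  also have "\<dots> = x' \<cdot> y' + b *s (d \<cdot> y') + b' *s (x' \<cdot> d) + (b * b') *s (d \<cdot> d)"
    using t by (simp add: mult_linear e_mult total_closed mult_total mult_zero
        scale_right_distrib algebra_simps)
  finally show ?thesis .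
qed

text \<open>The scalar \<open>\<alpha>\<close> of the extension is the \<open>e\<close>-coefficient
  of \<open>d \<cdot> d\<close>, that is \<open>B d (d \<cdot> d)\<close>.\<close>

lemma coords_mult:
  assumes "x \<in> total A" "y \<in> total A"
  shows "coords (x \<cdot> y) = dext_mult scale multH B \<delta> D a0 (B d (d \<cdot> d)) (coords x) (coords y)"
proof -
  define x' y' b b' where "x' = proj x" "y' = proj y" "b = B e x" "b' = B e y"
  note xyb = this
  have h: "x' \<in> total H" "y' \<in> total H"
    unfolding xyb using assms proj_total by blast+
  note t = in_total_H(1)[OF h(1)] in_total_H(1)[OF h(2)]
  note xy = mult_decomposition[OF assms, folded xyb]
  \<comment> \<open>These are the \<open>e\<close>-coefficients of \<open>d \<cdot> z\<close> and
    \<open>z \<cdot> d\<close>; invariance gathers the two factors \<open>d\<close>, and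
    \<open>z\<close> only sees the projection of \<open>d \<cdot> d\<close>.\<close>
  have da: "B d (d \<cdot> z) = B z a0" "B d (z \<cdot> d) = B z a0" if "z \<in> total H" for z
  proof -
    have z: "z \<in> total A" using that in_total_H by blast
    have "B d (d \<cdot> z) = B (d \<cdot> d) z" using invariant z by simp
    also have "\<dots> = B z (d \<cdot> d)"
      using form_commute_even mult_graded[OF d_even d_even] z by simp
    also have "\<dots> = B z a0"
      unfolding a0_def using that by (simp add: form_proj mult_total)
    finally show *: "B d (d \<cdot> z) = B z a0" .
    have "B d (z \<cdot> d) = B (d \<cdot> z) d" using invariant z by simp
    also have "\<dots> = B d (d \<cdot> z)"
      using form_commute_even[OF d_even] z mult_total by simp
    finally show "B d (z \<cdot> d) = B z a0" using * by simp
  qed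
  have "B d (x' \<cdot> y') = B (\<delta> x') y'"
    unfolding \<delta>_def using invariant h t by (simp add: form_proj mult_total)
  then have "B d (x \<cdot> y) = B (\<delta> x') y' + b * B y' a0 + b' * B x' a0 + b * b' * B d (d \<cdot> d)"
    unfolding xy using t h
    by (simp add: form_add_right form_scale_right total_closed mult_total da)
  moreover have "proj (x \<cdot> y) = multH x' y' + b *s \<delta> y' + b' *s D x' + (b * b') *s a0"
    unfolding xy multH_def \<delta>_def D_def a0_def using t
    by (simp add: proj_linear total_closed mult_total)
  ultimately show ?thesis
    unfolding coords_def dext_mult_def using assms xyb by (simp add: form_e_mult)
qed

lemma isomorphic_extension:
  "superalgebra_isomorphic scale A mult
     (dext_scale scale) (dext_part H) (dext_mult scale multH B \<delta> D a0 (B d (d \<cdot> d)))"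
  unfolding superalgebra_isomorphic_def
  by (intro exI[of _ coords] conjI allI ballI coords_linear coords_bij coords_image coords_mult)

end

section \<open>Existence of a hyperbolic pair, possibly for another form\<close>

context quadratic_zinbiel_superalgebra
begin

lemma isotropic_hyperbolic_pair:
  assumes two: "(2::'k) \<noteq> 0"
    and e: "e \<in> annihilator A mult" "e \<in> A 0" "e \<noteq> 0" "B e e = 0"
  obtains d where "hyperbolic_pair scale A mult B e d"
proof -
  have et: "e \<in> total A" using e(2) by (rule part_total)
  then obtain y where "y \<in> total A" "B e y \<noteq> 0"
    using nondegenerate e(3) by blast
  \<comment> \<open>The odd component of \<open>y\<close> is orthogonal to \<open>e\<close>, so the
    even one already pairs nontrivially.\<close>
  then obtain v where v: "v \<in> A 0" "B e v \<noteq> 0"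
    using even_form[OF e(2)] by (metis total_cases form_add_right part_total et add.right_neutral)
  define u where "u = (1 / B e v) *s v"
  \<comment> \<open>Subtracting c times \<open>e\<close> from \<open>u\<close> lowers
    \<open>B u u\<close> by 2c and keeps the pairing with \<open>e\<close>, which fixes the
    coefficient.\<close>
  define d where "d = u - (B u u / 2) *s e"
  have u: "u \<in> A 0" "B e u = 1"
    using v et part_total unfolding u_def by (simp_all add: part_closed form_scale_right)
  moreover have "u \<in> total A" "B u e = 1"
    using u part_total form_commute_even[OF e(2)] by auto
  ultimately have "d \<in> A 0" "B e d = 1" "B d d = 0"
    using e et two unfolding d_def
    by (simp_all add: part_closed total_closed form_diff_left form_diff_right
        form_scale_left form_scale_right)
  then have "hyperbolic_pair scale A mult B e d"
    using two e by unfold_locales auto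
  then show thesis by (rule that)
qed

lemma anisotropic_annihilator_mult_eq_0:
  assumes two: "(2::'k) \<noteq> 0"
    and aniso: "\<And>a. a \<in> annihilator A mult \<Longrightarrow> a \<in> A 0 \<Longrightarrow> B a a = 0 \<Longrightarrow> a = 0"
    and t: "x \<in> total A" "y \<in> total A"
  shows "x \<cdot> y = 0"
proof -
  have even: "u \<cdot> v = 0" if "u \<in> A i" "v \<in> A i" for u v i
  proof (rule aniso)
    note uv = that[THEN part_total]
    show "u \<cdot> v \<in> annihilator A mult"
      unfolding annihilator_def using uv by (simp add: mult_total triple_product_eq_0[OF two])
    show "u \<cdot> v \<in> A 0"
      using mult_graded[OF that] by (cases i) simp_all
    show "B (u \<cdot> v) (u \<cdot> v) = 0"
      using uv by (simp add: invariant mult_total triple_product_eq_0[OF two] form_zero)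
  qed
  \<comment> \<open>A homogeneous \<open>w\<close> has the degree of \<open>u\<close> or of
    \<open>v\<close>; invariance multiplies \<open>w\<close> with that factor, and a product of two
    elements of equal degree is zero.\<close>
  have odd: "u \<cdot> v = 0" if uv: "u \<in> A i" "v \<in> A j" "i \<noteq> j" for u v i j
  proof (rule nondegenerate_homogeneous)
    note uvt = uv(1,2)[THEN part_total]
    show "u \<cdot> v \<in> total A" using uvt by (rule mult_total)
    fix w k assume w: "w \<in> A k"
    note wt = part_total[OF w]
    show "B (u \<cdot> v) w = 0"
    proof (cases "j = k")
      case True
      then show ?thesis using even[OF uv(2)] w uvt wt by (simp add: invariant form_zero)
    next
      case False
      then have "k = i" using uv(3) by (cases i; cases j; cases k) auto
      have "B (u \<cdot> v) w = ssign ((i + j) * k) * B w (u \<cdot> v)"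
        by (intro supersymmetric mult_graded uv w)
      also have "B w (u \<cdot> v) = B (w \<cdot> u) v"
        using invariant uvt wt by simp
      also have "\<dots> = 0"
        using even[OF _ uv(1)] w \<open>k = i\<close> uvt by (simp add: form_zero)
      finally show ?thesis by simp
    qed
  qed
  have hom: "u \<cdot> v = 0" if "u \<in> A i" "v \<in> A j" for u v i j
    using even odd that by (cases "i = j") auto
  obtain x0 x1 y0 y1 where "x0 \<in> A 0" "x1 \<in> A 1" "x = x0 + x1" "y0 \<in> A 0" "y1 \<in> A 1" "y = y0 + y1"
    using t by (metis total_cases)
  then show ?thesis
    by (simp add: mult_add total_closed part_total hom)
qed

lemma orthogonal_anisotropic_vector:
  assumes "dim (A 0) \<ge> 2" "e \<in> A 0" "B e e \<noteq> 0"
  obtains d where "d \<in> A 0" "d \<noteq> 0" "B e d = 0"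
proof -
  have "\<not> A 0 \<subseteq> span {e}"
    using dim_le_card[of "A 0" "{e}"] assms(1) by auto
  then obtain w where w: "w \<in> A 0" "w \<notin> span {e}" by blast
  \<comment> \<open>One Gram-Schmidt step; \<open>d\<close> is nonzero because \<open>w\<close> is
    not a multiple of \<open>e\<close>.\<close>
  define d where "d = w - (B e w / B e e) *s e"
  have "d \<noteq> 0"
    using w(2) span_scale[OF span_base[of e "{e}"]] unfolding d_def
    by (metis eq_iff_diff_eq_0 singletonI)
  moreover have "d \<in> A 0" "B e d = 0"
    using w assms(2,3) unfolding d_def
    by (simp_all add: part_closed part_total total_closed form_diff_right form_scale_right)
  ultimately show thesis using that by blast
qed

text \<open>
  On an algebra with zero product every even supersymmetric form is invariant, so the form on the
  plane spanned by two orthogonal anisotropic vectors can be replaced by a hyperbolic one.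
\<close>

lemma hyperbolic_pair_of_zero_mult:
  assumes two: "(2::'k) \<noteq> 0"
    and zero: "\<And>x y. x \<in> total A \<Longrightarrow> y \<in> total A \<Longrightarrow> x \<cdot> y = 0"
    and e: "e \<in> A 0" "B e e \<noteq> 0" and d: "d \<in> A 0" "B d d \<noteq> 0" and ed: "B e d = 0"
  obtains B' where "hyperbolic_pair scale A mult B' e d"
proof -
  note t = part_total[OF e(1)] part_total[OF d(1)]
  have de: "B d e = 0" using ed form_commute_even[OF e(1) t(2)] by simp
  \<comment> \<open>\<open>h\<close> and \<open>g\<close> are the coordinates along \<open>e\<close>
    and \<open>d\<close> of the orthogonal projection to their plane.\<close>
  define h where "h x = B e x / B e e" for x
  define g where "g x = B d x / B d d" for x
  \<comment> \<open>The diagonal form on the plane is subtracted and the hyperbolic one added;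
    \<open>B\<close> is kept on the orthogonal complement.\<close>
  define B' where "B' x y = B x y - h x * h y * B e e - g x * g y * B d d + h x * g y + g x * h y"
    for x y
  have hg: "h (x + y) = h x + h y" "g (x + y) = g x + g y"
    if "x \<in> total A" "y \<in> total A" for x y
    using that t unfolding h_def g_def by (simp_all add: form_add_right add_divide_distrib)
  have hg_scale: "h (c *s x) = c * h x" "g (c *s x) = c * g x" if "x \<in> total A" for x c
    using that t unfolding h_def g_def by (simp_all add: form_scale_right)
  have hg_odd: "h x = 0" "g x = 0" if "x \<in> A 1" for x
    using that even_form[OF e(1)] even_form[OF d(1)] unfolding h_def g_def by auto
  have vals: "h e = 1" "h d = 0" "g e = 0" "g d = 1"
    using e d ed de unfolding h_def g_def by auto
  have B'_right: "B' x e = g x" "B' x d = h x" if "x \<in> total A" for x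
  proof -
    have "B x e = h x * B e e" "B x d = g x * B d d"
      using form_commute_even[OF e(1) that] form_commute_even[OF d(1) that] e d
      unfolding h_def g_def by simp_all
    then show "B' x e = g x" "B' x d = h x" unfolding B'_def vals by simp_all
  qed
  have "quadratic_zinbiel_superalgebra scale A mult B'"
  proof
    show "left_zinbiel_superalgebra scale A mult \<or> right_zinbiel_superalgebra scale A mult"
      by (rule left_or_right_zinbiel)
    show "bilinear_on scale (total A) (*) B'"
      unfolding bilinear_on_def linear_on_def B'_def
      by (simp add: hg hg_scale form_linear algebra_simps)
    show "x = 0" if x: "x \<in> total A" "\<forall>y\<in>total A. B' x y = 0" for x
    proof (rule nondegenerate[OF x(1)])
      \<comment> \<open>Pairing with \<open>d\<close> and \<open>e\<close> gives \<open>h x\<close>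
        and \<open>g x\<close>; once both vanish, \<open>B' x\<close> coincides with
        \<open>B x\<close>.\<close>
      have "h x = 0" "g x = 0" using x B'_right t by metis+
      then show "\<forall>y\<in>total A. B x y = 0" using x(2) unfolding B'_def by simp
    qed
    show "B' x y = ssign (i * j) * B' y x" if "x \<in> A i" "y \<in> A j" for x y i j
      using supersymmetric[OF that] that hg_odd
      by (cases i; cases j) (simp_all add: B'_def ssign_def)
    show "B' (x \<cdot> y) z = B' x (y \<cdot> z)" if "x \<in> total A" "y \<in> total A" "z \<in> total A" for x y z
      using that t by (simp add: zero B'_def h_def g_def form_zero)
    show "B' x y = 0 \<and> B' y x = 0" if "x \<in> A 0" "y \<in> A 1" for x y
      using that even_form hg_odd by (simp add: B'_def)
  qed
  then interpret Q: quadratic_zinbiel_superalgebra scale A mult B' .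
  have "e \<in> annihilator A mult"
    unfolding annihilator_def using t zero by simp
  then have "hyperbolic_pair scale A mult B' e d"
    using two e(1) d(1) t by unfold_locales (simp_all add: B'_right vals)
  then show thesis by (rule that)
qed

lemma exists_hyperbolic_pair:
  assumes two: "(2::'k) \<noteq> 0" and "dim (A 0) \<ge> 2" and "annihilator A mult \<inter> A 0 \<noteq> {0}"
  obtains B' e d where "hyperbolic_pair scale A mult B' e d"
proof (cases "\<exists>e \<in> annihilator A mult \<inter> A 0. e \<noteq> 0 \<and> B e e = 0")
  case True
  then show thesis using isotropic_hyperbolic_pair[OF two] that by blast
next
  case False
  then have zero: "x \<cdot> y = 0" if "x \<in> total A" "y \<in> total A" for x y
    using anisotropic_annihilator_mult_eq_0[OF two _ that] by blast
  \<comment> \<open>With zero product the annihilator is all of \<open>total A\<close>, so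
    anisotropy extends to the whole even part.\<close>
  then have aniso: "B a a \<noteq> 0" if "a \<in> A 0" "a \<noteq> 0" for a
    using False that part_total unfolding annihilator_def by auto
  have "0 \<in> annihilator A mult \<inter> A 0"
    unfolding annihilator_def by (simp add: total_closed mult_zero)
  then obtain e where e: "e \<in> A 0" "e \<noteq> 0" using assms(3) by blast
  obtain d where d: "d \<in> A 0" "d \<noteq> 0" "B e d = 0"
    using orthogonal_anisotropic_vector[OF assms(2) e(1) aniso[OF e]] by blast
  show thesis
    using hyperbolic_pair_of_zero_mult[OF two zero e(1) aniso[OF e] d(1) aniso[OF d(1,2)] d(3)] that
    by blast
qed

end

theorem theorem33:
  fixes scale :: "'k::field \<Rightarrow> 'v::ab_group_add \<Rightarrow> 'v"
    and A :: "bit \<Rightarrow> 'v set"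
    and mult :: "'v \<Rightarrow> 'v \<Rightarrow> 'v"
    and B :: "'v \<Rightarrow> 'v \<Rightarrow> 'k"
    and n m :: nat
  assumes char_not_2: "(2::'k) \<noteq> 0"
    and quadratic: "quadratic_zinbiel_superalgebra scale A mult B"
    and dim_even: "vector_space.dim scale (A 0) = n"
    and dim_odd: "vector_space.dim scale (A 1) = m"
    and "n \<ge> 2"
    and "annihilator A mult \<inter> A 0 \<noteq> {0}"
  shows "\<exists>(H :: bit \<Rightarrow> 'v set) (multH :: 'v \<Rightarrow> 'v \<Rightarrow> 'v) (BH :: 'v \<Rightarrow> 'v \<Rightarrow> 'k)
            (\<delta> :: 'v \<Rightarrow> 'v) (\<delta>' :: 'v \<Rightarrow> 'v) (a0 :: 'v) (\<alpha> :: 'k).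
           even_double_extension_data scale H multH BH \<delta> \<delta>' a0 \<and>
           vector_space.dim scale (H 0) = n - 2 \<and>
           vector_space.dim scale (H 1) = m \<and>
           superalgebra_isomorphic scale A mult
             (dext_scale scale) (dext_part H) (dext_mult scale multH BH \<delta> \<delta>' a0 \<alpha>)"
proof -
  interpret quadratic_zinbiel_superalgebra scale A mult B by (rule quadratic)
  \<comment> \<open>\<open>B'\<close> may differ from \<open>B\<close>; the complement then carries
    the restriction of \<open>B'\<close>, which is harmless since the isomorphism ignores
    forms.\<close>
  obtain B' e d where "hyperbolic_pair scale A mult B' e d"
    using exists_hyperbolic_pair char_not_2 dim_even assms(5,6) by blast
  then interpret P: hyperbolic_pair scale A mult B' e d .
  show ?thesis
    using P.extension_data P.dim_even_part P.odd_part P.isomorphic_extension dim_even dim_odd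
    by (intro exI[of _ P.H] exI[of _ P.multH] exI[of _ B'] exI[of _ P.\<delta>] exI[of _ P.D]
        exI[of _ P.a0] exI[of _ "B' d (mult d d)"]) simp
qed

end
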